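(* (a) For all integers $i \geq 0$, $f_{3,0}\!\left(\frac{65\cdot 4^{i+1}+1}{3}\right) = 55\cdot 3^i$. (b) For all integers $i \geq 0$, $f_{3,0}(2\cdot 4^i) = 2\cdot 3^i$.
   Context: Let $t(n)$ be the number of $1$'s in the base-$2$ representation of $n$, taken modulo $2$. Define $f_{3,0}(n) = \sum_{0 \leq i < n} (-1)^{t(3i)}$ for $n \geq 0$. *)

theory Defs
  imports Main
begin

definition t :: "nat \<Rightarrow> nat" where
  "t n = card {k. bit n k} mod 2"

definition f30 :: "nat \<Rightarrow> int" where
  "f30 n = (\<Sum>i<n. (- 1) ^ t (3 * i))"

text \<open>The set of bit positions is finite, so \<open>card\<close> in the definition of
  \<open>t\<close> really counts the ones.\<close>

lemma finite_bit_positions: "finite {k. bit (n::nat) k}"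
proof (rule finite_subset)
  show "{k. bit n k} \<subseteq> {..<n}"
  proof
    fix k
    assume "k \<in> {k. bit n k}"
    then have "2 ^ k \<le> n"
      by (auto simp: bit_iff_odd intro: ccontr)
    with less_exp [of k] have "k < n"
      by (rule less_le_trans)
    then show "k \<in> {..<n}"
      by simp
  qed
qed simp

text \<open>The quotient \<open>(65 * 4 ^ (i + 1) + 1) div 3\<close> is exact.\<close>

lemma three_dvd_65_4_power: "(3::nat) dvd 65 * 4 ^ (i + 1) + 1"
proof (induction i)
  case (Suc i)
  have "65 * 4 ^ (Suc i + 1) + 1 = (65 * 4 ^ (i + 1) + 1) + 3 * (65 * 4 ^ (i + 1) :: nat)"
    by simp
  then show ?case
    using Suc.IH by (metis dvd_add dvd_triv_left)
qed simp

end

(* Grouping the integers below 4 N into blocks {4 q, 4 q + 1, 4 q + 2, 4 q + 3}, whose signs are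
   those of q times +, -, -, +, and using 4 q + d = q + d modulo 3, one sees that quadrupling N
   triples the signed count of the multiples of 3 below N, up to the full signed sum below N,
   which vanishes for even N. *)

theory Submission
  imports Defs
begin

definition thue_morse_sign :: "nat \<Rightarrow> int" where
  "thue_morse_sign n = (- 1) ^ t n"

definition sign_sum :: "nat \<Rightarrow> int" where
  "sign_sum N = (\<Sum>m<N. thue_morse_sign m)"

text \<open>Filtering all \<open>m < N\<close>, instead of indexing the multiples as
  \<open>3 * i\<close>, gives meaning to bounds that are not multiples of 3, such as 4 and 65
  below.\<close>

definition sign_sum3 :: "nat \<Rightarrow> int" where
  "sign_sum3 N = (\<Sum>m<N. if 3 dvd m then thue_morse_sign m else 0)"

lemma thue_morse_sign_card: "thue_morse_sign n = (- 1) ^ card {k. bit n k}"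
  by (simp add: thue_morse_sign_def t_def minus_one_power_iff even_mod_2_iff)

lemma thue_morse_sign_0 [simp]: "thue_morse_sign 0 = 1"
  by (simp add: thue_morse_sign_card)

lemma bit_positions_double: "{k. bit (2 * n :: nat) k} = Suc ` {k. bit n k}"
proof (rule set_eqI)
  fix k show "k \<in> {k. bit (2 * n) k} \<longleftrightarrow> k \<in> Suc ` {k. bit n k}"
    by (cases k) (auto simp: bit_0 bit_Suc)
qed

lemma bit_positions_double_Suc:
  "{k. bit (2 * n + 1 :: nat) k} = insert 0 (Suc ` {k. bit n k})"
proof (rule set_eqI)
  fix k show "k \<in> {k. bit (2 * n + 1) k} \<longleftrightarrow> k \<in> insert 0 (Suc ` {k. bit n k})"
    by (cases k) (auto simp: bit_0 bit_Suc)
qed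

lemma thue_morse_sign_double: "thue_morse_sign (2 * n) = thue_morse_sign n"
  by (simp only: thue_morse_sign_card bit_positions_double card_image inj_Suc)

lemma thue_morse_sign_double_Suc: "thue_morse_sign (2 * n + 1) = - thue_morse_sign n"
  by (simp only: thue_morse_sign_card bit_positions_double_Suc)
    (simp add: card_image finite_bit_positions)

lemma thue_morse_sign_quad:
  "thue_morse_sign (4 * n) = thue_morse_sign n"
  "thue_morse_sign (4 * n + 1) = - thue_morse_sign n"
  "thue_morse_sign (4 * n + 2) = - thue_morse_sign n"
  "thue_morse_sign (4 * n + 3) = thue_morse_sign n"
proof -
  have "4 * n = 2 * (2 * n)" "4 * n + 1 = 2 * (2 * n) + 1"
    "4 * n + 2 = 2 * (2 * n + 1)" "4 * n + 3 = 2 * (2 * n + 1) + 1"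
    by simp_all
  then show
    "thue_morse_sign (4 * n) = thue_morse_sign n"
    "thue_morse_sign (4 * n + 1) = - thue_morse_sign n"
    "thue_morse_sign (4 * n + 2) = - thue_morse_sign n"
    "thue_morse_sign (4 * n + 3) = thue_morse_sign n"
    by (simp_all only: thue_morse_sign_double thue_morse_sign_double_Suc minus_minus)
qed

text \<open>The terms at \<open>2 * k\<close> and \<open>2 * k + 1\<close> cancel, since the
  appended binary digit 1 flips the sign.\<close>

lemma sign_sum_even: "even N \<Longrightarrow> sign_sum N = 0"
proof (elim evenE, hypsubst)
  fix n show "sign_sum (2 * n) = 0"
    using thue_morse_sign_double thue_morse_sign_double_Suc
    by (induction n) (simp_all add: sign_sum_def)
qed

lemma sign_sum3_quad: "sign_sum3 (4 * N) = 3 * sign_sum3 N - sign_sum N"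
proof (induction N)
  case 0
  then show ?case by (simp add: sign_sum3_def sign_sum_def)
next
  case (Suc N)
  let ?g = "\<lambda>m. if 3 dvd m then thue_morse_sign m else 0"
  have "{..<4 * Suc N} = insert (4 * N + 3) (insert (4 * N + 2) (insert (4 * N + 1)
      (insert (4 * N) {..<4 * N})))"
    by auto
  then have "sign_sum3 (4 * Suc N)
      = sign_sum3 (4 * N) + (?g (4 * N) + ?g (4 * N + 1) + ?g (4 * N + 2) + ?g (4 * N + 3))"
    unfolding sign_sum3_def by simp
  also have "?g (4 * N) + ?g (4 * N + 1) + ?g (4 * N + 2) + ?g (4 * N + 3)
      = 3 * ?g N - thue_morse_sign N"
  proof -
    \<comment> \<open>With \<open>s\<close> the sign of \<open>N\<close>: for residue 0 both ends of
      the block count, giving s + s = 3s - s; for residues 1 and 2 a single inner element counts,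
      giving -s = 0 - s.\<close>
    have dvd: "3 dvd 4 * N \<longleftrightarrow> N mod 3 = 0" "3 dvd 4 * N + 1 \<longleftrightarrow> N mod 3 = 2"
      "3 dvd 4 * N + 2 \<longleftrightarrow> N mod 3 = 1" "3 dvd 4 * N + 3 \<longleftrightarrow> N mod 3 = 0"
      "3 dvd N \<longleftrightarrow> N mod 3 = 0"
      by presburger+
    consider "N mod 3 = 0" | "N mod 3 = 1" | "N mod 3 = 2"
      by linarith
    then show ?thesis
      unfolding dvd thue_morse_sign_quad by cases simp_all
  qed
  finally show ?case
    using Suc.IH by (simp add: sign_sum3_def sign_sum_def)
qed

text \<open>All bounds \<open>N * 4 ^ i\<close> stay even, so the correction \<open>sign_sum\<close>
  vanishes at each quadrupling and only the factor 3 remains.\<close>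

lemma sign_sum3_even_times_4_power:
  assumes "even N"
  shows "sign_sum3 (N * 4 ^ i) = sign_sum3 N * 3 ^ i"
proof (induction i)
  case (Suc i)
  have "sign_sum3 (N * 4 ^ Suc i) = sign_sum3 (4 * (N * 4 ^ i))"
    by (simp add: mult.left_commute)
  with Suc.IH assms show ?case
    by (simp add: sign_sum3_quad sign_sum_even)
qed simp

text \<open>Each step of \<open>n\<close> adds three integers to the range, of which only
  \<open>3 * n\<close> is a multiple of 3.\<close>

lemma f30_eq_sign_sum3: "f30 n = sign_sum3 (3 * n)"
proof (induction n)
  case (Suc n)
  have three: "3 * Suc n = Suc (Suc (Suc (3 * n)))"
    and not_dvd: "\<not> 3 dvd Suc (3 * n)" "\<not> 3 dvd Suc (Suc (3 * n))"
    by presburger+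
  have "sign_sum3 (3 * Suc n) = sign_sum3 (3 * n) + thue_morse_sign (3 * n)"
    unfolding sign_sum3_def three sum.lessThan_Suc using not_dvd by simp
  with Suc.IH show ?case
    by (simp add: f30_def thue_morse_sign_def)
qed (simp add: f30_def sign_sum3_def)

lemma sign_sum3_Suc_not_dvd: "\<not> 3 dvd N \<Longrightarrow> sign_sum3 (Suc N) = sign_sum3 N"
  by (simp add: sign_sum3_def)

lemma sign_sum3_4: "sign_sum3 4 = 2"
proof -
  \<comment> \<open>The bound 1 is odd, so the correction survives: 3 * 1 - 1 = 2.\<close>
  have "sign_sum3 (4 * 1) = 3 * sign_sum3 1 - sign_sum 1"
    by (rule sign_sum3_quad)
  then show ?thesis
    by (simp add: sign_sum3_def sign_sum_def)
qed

text \<open>Base value for (b), where the bound is 3 * 2 * 4^i = 6 * 4^i.\<close>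

lemma sign_sum3_6: "sign_sum3 6 = 2"
  using sign_sum3_Suc_not_dvd[of 4] sign_sum3_Suc_not_dvd[of 5] sign_sum3_4 by simp

text \<open>Base value for (a). Here 260 = 4 * 65 with 65 odd, so the correction contributes once: 3
  * 18 - (-1) = 55.\<close>

lemma sign_sum3_260: "sign_sum3 260 = 55"
proof -
  \<comment> \<open>Since 64 = 4 * 4^2, the value at 64 is 2 * 3^2 = 18, and 64 is not a multiple of
    3.\<close>
  have "sign_sum3 65 = 18"
    using sign_sum3_even_times_4_power[of 4 2] sign_sum3_Suc_not_dvd[of 64]
    by (simp add: sign_sum3_4)
  moreover have "sign_sum 65 = thue_morse_sign 64"
    using sign_sum_even[of 64] sum.lessThan_Suc[of thue_morse_sign 64] by (simp add: sign_sum_def)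
  moreover have "thue_morse_sign 64 = - 1"
    using thue_morse_sign_quad(1)[of 16] thue_morse_sign_quad(1)[of 4]
      thue_morse_sign_quad(1)[of 1] thue_morse_sign_quad(2)[of 0]
    by simp
  ultimately show ?thesis
    using sign_sum3_quad[of 65] by simp
qed

theorem theorem6:
  shows "(\<forall>i::nat. f30 ((65 * 4 ^ (i + 1) + 1) div 3) = 55 * 3 ^ i) \<and>
    (\<forall>i::nat. f30 (2 * 4 ^ i) = 2 * 3 ^ i)"
proof (intro conjI allI)
  fix i :: nat
  have exact: "3 * ((65 * 4 ^ (i + 1) + 1) div 3) = Suc (260 * 4 ^ i)"
    using three_dvd_65_4_power[of i] by (simp add: dvd_mult_div_cancel)
  \<comment> \<open>The bound in (a) exceeds 260 * 4^i by one. Being the predecessor of a multiple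
    of 3, the top index 260 * 4^i contributes nothing.\<close>
  have "\<not> 3 dvd M" if "3 * q = Suc M" for q M :: nat
    using that by presburger
  with exact have not_dvd: "\<not> 3 dvd 260 * (4::nat) ^ i"
    by blast
  show "f30 ((65 * 4 ^ (i + 1) + 1) div 3) = 55 * 3 ^ i"
    unfolding f30_eq_sign_sum3 exact sign_sum3_Suc_not_dvd[OF not_dvd]
    by (simp add: sign_sum3_even_times_4_power sign_sum3_260)
next
  fix i :: nat
  show "f30 (2 * 4 ^ i) = 2 * 3 ^ i"
    using sign_sum3_even_times_4_power[of 6 i] by (simp add: f30_eq_sign_sum3 sign_sum3_6)
qed

end
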